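(* Let $l,s$ be non-negative integers with $0\le s\le l$. The polynomial $f(x)=F_{2,l}^{(2l-s,s)}(-x)$, where $F_{2,l}^{(2l-s,s)}(\alpha)$ is the (scalar) transition matrix defined in the context, satisfies the differential equation $$\left\{\frac{d^2}{dx^2}+\left(\frac{2}{x-1}-\frac{l}{x}\right)\frac{d}{dx}+\frac{s-(l-s)^2-lx}{x(x-1)^2}\right\}f(x)=0 .$$
   Context: Let $X=(x_{ij})_{1\le i,j\le 2}$ be a matrix of variables. For $k_1,k_2\in\{1,2\}$ put $D^{(\alpha)}(k_1,k_2)=x_{k_11}x_{k_22}+\alpha\,x_{k_21}x_{k_12}$. Let $\mathbb{M}_{2,l}$ be the set of $2\times2$ matrices $M=(m_{ij})$ with nonnegative integer entries and both column sums equal to $l$. For $N\in\mathbb{M}_{2,1}$, $N=(\delta_{i,k_j})_{i,j}$, put $D^{(\alpha)}(N)=D^{(\alpha)}(k_1,k_2)$, and for $M\in\mathbb{M}_{2,l}$ put $$D^{(\alpha)}(M)=\frac{\prod_{i,j}m_{ij}!}{(l!)^2}\sum_{(M_1,\dots,M_l)}D^{(\alpha)}(M_1)\cdots D^{(\alpha)}(M_l),$$ the sum over all $(M_1,\dots,M_l)\in(\mathbb{M}_{2,1})^l$ with $\sum_i M_i=M$. Let $\boldsymbol e_1,\boldsymbol e_2$ be the standard basis of $\mathbb{C}^2$. The linear map $\Phi^{(\alpha)}:(\mathrm{Sym}^l(\mathbb{C}^2))^{\otimes2}\to\mathbb{C}[x_{11},x_{12},x_{21},x_{22}]$ is defined by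 $\Phi^{(\alpha)}(\boldsymbol e_1^{m_{11}}\boldsymbol e_2^{m_{21}}\otimes\boldsymbol e_1^{m_{12}}\boldsymbol e_2^{m_{22}})=D^{(\alpha)}(M)$. It is a $\mathcal{U}(\mathfrak{gl}_2)$-intertwiner for the natural action on the source and the action $E_{ij}\cdot f=\sum_{k}x_{ik}\,\partial f/\partial x_{jk}$ on polynomials. The space of highest weight vectors of weight $(2l-s,s)$ in $(\mathrm{Sym}^l(\mathbb{C}^2))^{\otimes2}$ is one-dimensional; let $v^{(2l-s,s)}$ be a nonzero element. Then $F_{2,l}^{(2l-s,s)}(\alpha)$ is the unique scalar (a polynomial in $\alpha$) with $\Phi^{(\alpha)}(v^{(2l-s,s)})=F_{2,l}^{(2l-s,s)}(\alpha)\,\Phi^{(0)}(v^{(2l-s,s)})$. The differential equation is an identity of rational functions of $x$. *)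

theory Defs
  imports
    "HOL-Analysis.Analysis"
    "HOL-Computational_Algebra.Computational_Algebra"
    "HOL-Library.Poly_Mapping"
    "HOL-Library.Product_Plus"
begin

text \<open>
  The index set \<open>{1, 2}\<close> is the type \<open>2\<close>, in which the numeral \<open>2\<close> denotes the element \<open>0\<close>,
  distinct from \<open>1\<close>. A \<open>2 \<times> 2\<close> matrix \<open>M\<close> of natural numbers has entries \<open>M $ i $ j\<close>
  with row \<open>i\<close> and column \<open>j\<close>.

  The polynomial ring \<open>\<complex>[x\<^sub>1\<^sub>1, x\<^sub>1\<^sub>2, x\<^sub>2\<^sub>1, x\<^sub>2\<^sub>2]\<close> is the monoid algebra of exponent matrices, with the
  convolution product of \<^theory>\<open>HOL-Library.Poly_Mapping\<close>. In the same way the symmetric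
  algebra of \<open>\<complex>\<^sup>2\<close> has the basis \<open>e\<^sub>1\<^bsup>a$1\<^esup> e\<^sub>2\<^bsup>a$2\<^esup>\<close> indexed by \<open>a :: nat^2\<close>, and its tensor square
  has the basis of pure tensors of two such monomials, indexed by pairs.
\<close>

type_synonym xpoly = "(nat^2^2) \<Rightarrow>\<^sub>0 complex"
type_synonym sym = "(nat^2) \<Rightarrow>\<^sub>0 complex"
type_synonym sym_tensor = "((nat^2) \<times> (nat^2)) \<Rightarrow>\<^sub>0 complex"

definition scale :: "complex \<Rightarrow> ('a \<Rightarrow>\<^sub>0 complex) \<Rightarrow> ('a \<Rightarrow>\<^sub>0 complex)" where
  "scale c p = Poly_Mapping.map (\<lambda>z. c * z) p"

text \<open>The linear map with prescribed values on the basis elements \<open>Poly_Mapping.single k 1\<close>.\<close>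

definition lin_ext :: "('a \<Rightarrow> ('b \<Rightarrow>\<^sub>0 complex)) \<Rightarrow> ('a \<Rightarrow>\<^sub>0 complex) \<Rightarrow> ('b \<Rightarrow>\<^sub>0 complex)" where
  "lin_ext g t = (\<Sum>k\<in>Poly_Mapping.keys t. scale (Poly_Mapping.lookup t k) (g k))"

definition X :: "2 \<Rightarrow> 2 \<Rightarrow> xpoly" where
  "X i j = Poly_Mapping.single (axis i (axis j 1)) 1"

definition D_pair :: "complex \<Rightarrow> 2 \<Rightarrow> 2 \<Rightarrow> xpoly" where
  "D_pair \<alpha> k1 k2 = X k1 1 * X k2 2 + scale \<alpha> (X k2 1 * X k1 2)"

definition MM :: "nat \<Rightarrow> (nat^2^2) set" where
  "MM l = {M. \<forall>j. (\<Sum>i\<in>UNIV. M $ i $ j) = l}"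

text \<open>
  For \<open>N \<in> MM 1\<close>, the index \<open>k\<^sub>j\<close> with \<open>N $ i $ j = \<delta>\<^bsub>i, k\<^sub>j\<^esub>\<close> is the row of the unique \<open>1\<close> in column \<open>j\<close>.
\<close>

definition D_unit :: "complex \<Rightarrow> nat^2^2 \<Rightarrow> xpoly" where
  "D_unit \<alpha> N = D_pair \<alpha> (THE i. N $ i $ 1 = 1) (THE i. N $ i $ 2 = 1)"

definition D_mat :: "nat \<Rightarrow> complex \<Rightarrow> nat^2^2 \<Rightarrow> xpoly" where
  "D_mat l \<alpha> M =
     scale ((\<Prod>i\<in>UNIV. \<Prod>j\<in>UNIV. fact (M $ i $ j)) / (fact l)\<^sup>2)
       (\<Sum>Ms \<in> {Ms. length Ms = l \<and> set Ms \<subseteq> MM 1 \<and> sum_list Ms = M}.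
          prod_list (map (D_unit \<alpha>) Ms))"

text \<open>
  \<open>E\<^sub>i\<^sub>j\<close> acts on the symmetric algebra as the derivation sending \<open>e\<^sub>k\<close> to \<open>\<delta>\<^sub>j\<^sub>k e\<^sub>i\<close>. The truncated
  subtraction is harmless, since the coefficient vanishes if \<open>a $ j = 0\<close>.
\<close>

definition gl_sym :: "2 \<Rightarrow> 2 \<Rightarrow> sym \<Rightarrow> sym" where
  "gl_sym i j = lin_ext (\<lambda>a. Poly_Mapping.single (a - axis j 1 + axis i 1) (of_nat (a $ j)))"

definition tensor :: "sym \<Rightarrow> sym \<Rightarrow> sym_tensor" where
  "tensor u w = lin_ext (\<lambda>a. lin_ext (\<lambda>b. Poly_Mapping.single (a, b) 1) w) u"

definition gl_tensor :: "2 \<Rightarrow> 2 \<Rightarrow> sym_tensor \<Rightarrow> sym_tensor" where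
  "gl_tensor i j = lin_ext (\<lambda>(a, b).
     tensor (gl_sym i j (Poly_Mapping.single a 1)) (Poly_Mapping.single b 1) +
     tensor (Poly_Mapping.single a 1) (gl_sym i j (Poly_Mapping.single b 1)))"

definition sym_pow_tensor :: "nat \<Rightarrow> sym_tensor set" where
  "sym_pow_tensor l = {t. \<forall>(a, b) \<in> Poly_Mapping.keys t.
     (\<Sum>i\<in>UNIV. a $ i) = l \<and> (\<Sum>i\<in>UNIV. b $ i) = l}"

text \<open>The zero vector is included.\<close>

definition hw_space :: "nat \<Rightarrow> nat \<Rightarrow> nat \<Rightarrow> sym_tensor set" where
  "hw_space l m1 m2 = {v \<in> sym_pow_tensor l.
     gl_tensor 1 1 v = scale (of_nat m1) v \<and>
     gl_tensor 2 2 v = scale (of_nat m2) v \<and>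
     gl_tensor 1 2 v = 0}"

text \<open>
  The basis element indexed by \<open>(a, b)\<close> corresponds to the matrix with columns \<open>a\<close> and \<open>b\<close>.
\<close>

definition Phi :: "nat \<Rightarrow> complex \<Rightarrow> sym_tensor \<Rightarrow> xpoly" where
  "Phi l \<alpha> = lin_ext (\<lambda>(a, b). D_mat l \<alpha> (\<chi> i j. if j = 1 then a $ i else b $ i))"

text \<open>
  For \<open>s \<le> l\<close> the space \<open>hw_space l (2 * l - s) s\<close> is one-dimensional, so the choice of the nonzero
  vector does not affect \<open>transition\<close>.
\<close>

definition hw_vec :: "nat \<Rightarrow> nat \<Rightarrow> sym_tensor" where
  "hw_vec l s = (SOME v. v \<in> hw_space l (2 * l - s) s \<and> v \<noteq> 0)"

definition transition :: "nat \<Rightarrow> nat \<Rightarrow> complex \<Rightarrow> complex" where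
  "transition l s \<alpha> = (THE c. Phi l \<alpha> (hw_vec l s) = scale c (Phi l 0 (hw_vec l s)))"

text \<open>The indeterminate of the field \<open>\<complex>(x)\<close>.\<close>

definition ratx :: "complex poly fract" where
  "ratx = to_fract [:0, 1:]"

end

(*
  The polynomial Phi(v) is the contraction of v with the l-th power of
    Q = (a.x1)(b.x2) + alpha (b.x1)(a.x2),
  where xk is the k-th column of x and a, b are vectors of auxiliary variables. As Q is invariant
  under the joint gl_2-action, Phi(v) is annihilated by E_12, and this together with its
  multidegree determines it up to a scalar. Comparing the coefficients of
  x11^l x12^(l-s) x22^s, where only Q at x21 = 0 matters, gives
    F(alpha) = (1 + alpha)^(l-s) 2F1(-s, l-s+1; -l; -alpha),
  and the differential equation is the hypergeometric equation twisted by (1-x)^(l-s).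
*)
theory Submission
  imports Defs
begin

text \<open>The factorials in \<open>D_mat\<close> are those of the apolar pairing, which is why the
  sum over tuples collapses to a contraction with a power of Q; invariance of that power is then a
  Leibniz computation on linear forms. The vectors v and Phi(v) satisfy the same recurrence under
  E_12, and its solutions form a line, so a single coefficient decides the scalar. At alpha = 0 the
  hypergeometric formula takes the value 1, so that coefficient is already normalised. The exponent
  l - s of the twist is a root of the indicial equation r (r + 1) = (l - s)(l - s + 1) of the
  differential equation at x = 1.\<close>

no_notation fps_nth (infixl "$" 75)

section \<open>Linear extensions on monoid algebras\<close>

lemma lookup_scale [simp]: "Poly_Mapping.lookup (scale c p) k = c * Poly_Mapping.lookup p k"
  by (simp add: scale_def Poly_Mapping.map.rep_eq when_def)

lemma scale_simps [simp]:
  "scale 0 p = 0" "scale 1 p = p" "scale c 0 = 0"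
  "scale c (Poly_Mapping.single k d) = Poly_Mapping.single k (c * d)"
  "scale c (scale d p) = scale (c * d) p"
  by (auto intro!: poly_mapping_eqI simp: lookup_single when_def)

lemma scale_add: "scale c (p + q) = scale c p + scale c q"
  and scale_left_add: "scale (c + d) p = scale c p + scale d p"
  and scale_sum: "scale c (\<Sum>i\<in>I. f i) = (\<Sum>i\<in>I. scale c (f i))"
  by (auto intro!: poly_mapping_eqI simp: lookup_add lookup_sum algebra_simps sum_distrib_left)

lemma scale_eq_mult: "scale c p = Poly_Mapping.single 0 c * p"
  for p :: "'a::comm_monoid_add \<Rightarrow>\<^sub>0 complex"
proof -
  have p: "p = (\<Sum>k\<in>Poly_Mapping.keys p. Poly_Mapping.single k (Poly_Mapping.lookup p k))"
    by (rule poly_mapping_eqI)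
       (auto simp: lookup_sum lookup_single when_def in_keys_iff)
  show ?thesis
    by (subst p, subst (2) p)
       (simp add: scale_sum sum_distrib_left mult_single)
qed

lemma scale_mult_left: "scale c p * q = scale c (p * q)"
  and scale_mult_right: "p * scale c q = scale c (p * q)"
  for p q :: "'a::comm_monoid_add \<Rightarrow>\<^sub>0 complex"
  by (simp_all add: scale_eq_mult ac_simps)

lemma lin_ext_superset:
  assumes "finite K" "Poly_Mapping.keys p \<subseteq> K"
  shows "lin_ext g p = (\<Sum>k\<in>K. scale (Poly_Mapping.lookup p k) (g k))"
  unfolding lin_ext_def using assms
  by (intro sum.mono_neutral_left) (auto simp: in_keys_iff)

lemma lin_ext_single [simp]: "lin_ext g (Poly_Mapping.single k c) = scale c (g k)"
  by (subst lin_ext_superset[of "{k}"]) auto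

lemma lin_ext_0 [simp]: "lin_ext g 0 = 0"
  by (simp add: lin_ext_def)

lemma lin_ext_add: "lin_ext g (p + q) = lin_ext g p + lin_ext g q"
proof -
  let ?K = "Poly_Mapping.keys p \<union> Poly_Mapping.keys q"
  have "Poly_Mapping.keys (p + q) \<subseteq> ?K" by (rule keys_add)
  then show ?thesis
    by (simp add: lin_ext_superset[of ?K] lookup_add scale_left_add sum.distrib)
qed

lemma lin_ext_sum: "lin_ext g (\<Sum>i\<in>I. f i) = (\<Sum>i\<in>I. lin_ext g (f i))"
  by (induction I rule: infinite_finite_induct) (auto simp: lin_ext_add)

lemma lin_ext_scale: "lin_ext g (scale c p) = scale c (lin_ext g p)"
proof -
  have "Poly_Mapping.keys (scale c p) \<subseteq> Poly_Mapping.keys p"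
    by (auto simp: in_keys_iff)
  then show ?thesis
    by (simp add: lin_ext_superset[of "Poly_Mapping.keys p"] scale_sum)
qed

lemma lin_ext_plus: "lin_ext (\<lambda>k. g k + h k) p = lin_ext g p + lin_ext h p"
  by (simp add: lin_ext_def scale_add sum.distrib)

lemma lin_ext_lin_ext: "lin_ext g (lin_ext h p) = lin_ext (\<lambda>k. lin_ext g (h k)) p"
  by (simp add: lin_ext_def[of h] lin_ext_def[of "\<lambda>k. lin_ext g (h k)"] lin_ext_sum lin_ext_scale)

lemma lookup_lin_ext:
  "Poly_Mapping.lookup (lin_ext g p) k =
     (\<Sum>j\<in>Poly_Mapping.keys p. Poly_Mapping.lookup p j * Poly_Mapping.lookup (g j) k)"
  by (simp add: lin_ext_def lookup_sum)

text \<open>The shifts in use involve truncated subtraction and are injective only where the weight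
  is nonzero, so the preimage is prescribed there alone.\<close>

lemma lookup_lin_ext_shift:
  assumes "\<And>j. w j \<noteq> 0 \<Longrightarrow> f j = k \<longleftrightarrow> j = i"
  shows "Poly_Mapping.lookup (lin_ext (\<lambda>j. Poly_Mapping.single (f j) (w j)) p) k =
    Poly_Mapping.lookup p i * w i"
proof -
  have "Poly_Mapping.lookup (lin_ext (\<lambda>j. Poly_Mapping.single (f j) (w j)) p) k =
      (\<Sum>j\<in>Poly_Mapping.keys p. if j = i then Poly_Mapping.lookup p j * w j else 0)"
    unfolding lookup_lin_ext
  proof (rule sum.cong)
    fix j
    show "Poly_Mapping.lookup p j * Poly_Mapping.lookup (Poly_Mapping.single (f j) (w j)) k =
        (if j = i then Poly_Mapping.lookup p j * w j else 0)"
      using assms[of j] by (cases "w j = 0") (auto simp: lookup_single when_def)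
  qed simp
  also have "\<dots> = Poly_Mapping.lookup p i * w i"
    by (simp add: in_keys_iff)
  finally show ?thesis .
qed

lemma lookup_lin_ext_shift_0:
  assumes "\<And>j. f j = k \<Longrightarrow> w j = 0"
  shows "Poly_Mapping.lookup (lin_ext (\<lambda>j. Poly_Mapping.single (f j) (w j)) p) k = 0"
  unfolding lookup_lin_ext using assms
  by (intro sum.neutral) (auto simp: lookup_single when_def)

section \<open>Derivations of monoid algebras\<close>

lemma monoid_algebra_induct [case_names single zero add]:
  fixes p :: "'a \<Rightarrow>\<^sub>0 complex"
  assumes "\<And>k c. P (Poly_Mapping.single k c)" "P 0" "\<And>p q. P p \<Longrightarrow> P q \<Longrightarrow> P (p + q)"
  shows "P p"
proof -
  have p: "p = (\<Sum>k\<in>Poly_Mapping.keys p. Poly_Mapping.single k (Poly_Mapping.lookup p k))"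
    by (rule poly_mapping_eqI)
       (auto simp: lookup_sum lookup_single when_def in_keys_iff)
  have "P (\<Sum>k\<in>K. Poly_Mapping.single k (Poly_Mapping.lookup p k))" for K
    by (induction K rule: infinite_finite_induct) (auto intro: assms)
  then show ?thesis by (subst p)
qed

lemma lin_ext_derivation:
  fixes p q :: "'a::comm_monoid_add \<Rightarrow>\<^sub>0 complex"
  assumes "\<And>j k. d (j + k) = Poly_Mapping.single j 1 * d k + Poly_Mapping.single k 1 * d j"
  shows "lin_ext d (p * q) = p * lin_ext d q + q * lin_ext d p"
proof (induction p rule: monoid_algebra_induct)
  case (single j c)
  show ?case
  proof (induction q rule: monoid_algebra_induct)
    case (single k e)
    have s: "Poly_Mapping.single i b * r = scale b (Poly_Mapping.single i 1 * r)"
      for i b and r :: "'a \<Rightarrow>\<^sub>0 complex"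
      by (simp flip: scale_mult_left)
    show ?case
      by (simp add: mult_single assms scale_add s[of j c] s[of k e] scale_mult_right mult.commute[of c e])
  qed (auto simp: lin_ext_add algebra_simps)
qed (auto simp: lin_ext_add algebra_simps)

text \<open>The model is x_i d/dx_j on monomials: \<open>c\<close> is the exponent of x_j and
  \<open>f\<close> trades one x_j for an x_i. Truncated subtraction lets \<open>f\<close> commute
  with adding \<open>j\<close> only if that exponent is positive; otherwise the coefficient kills
  the term.\<close>

lemma shift_derivation:
  fixes f :: "'a::comm_monoid_add \<Rightarrow> 'a" and c :: "'a \<Rightarrow> complex"
  assumes c: "\<And>j k. c (j + k) = c j + c k"
    and f: "\<And>j k. c k \<noteq> 0 \<Longrightarrow> f (j + k) = j + f k"
  shows "Poly_Mapping.single (f (j + k)) (c (j + k)) =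
    Poly_Mapping.single j 1 * Poly_Mapping.single (f k) (c k) +
    Poly_Mapping.single k 1 * Poly_Mapping.single (f j) (c j)"
proof -
  have *: "f (j + k) = k + f j" if "c j \<noteq> 0"
    using f[OF that, of k] by (simp add: add.commute)
  show ?thesis
    using f[of k j] * by (cases "c j = 0"; cases "c k = 0") (auto simp: mult_single c single_add)
qed

lemma derivation_power_eq_0:
  fixes d :: "'a::comm_ring_1 \<Rightarrow> 'a"
  assumes "\<And>p q. d (p * q) = p * d q + q * d p" "d p = 0"
  shows "d (p ^ n) = 0"
proof (induction n)
  case 0
  \<comment> \<open>Leibniz at 1 * 1 gives d 1 = d 1 + d 1.\<close>
  show ?case using assms(1)[of 1 1] by simp
qed (simp add: assms)

text \<open>Words rather than multisets, because \<open>D_mat\<close> sums over ordered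
  tuples.\<close>

lemma sum_power_eq_sum_lists:
  fixes g :: "'a \<Rightarrow> 'b::comm_semiring_1"
  assumes "finite S"
  shows "(\<Sum>x\<in>S. g x) ^ n = (\<Sum>xs\<in>{xs. length xs = n \<and> set xs \<subseteq> S}. prod_list (map g xs))"
proof (induction n)
  case 0
  have "{xs :: 'a list. length xs = 0 \<and> set xs \<subseteq> S} = {[]}" by auto
  then show ?case by simp
next
  case (Suc n)
  let ?A = "{xs. length xs = n \<and> set xs \<subseteq> S}"
  have eq: "{xs. length xs = Suc n \<and> set xs \<subseteq> S} = (\<lambda>(x, xs). x # xs) ` (S \<times> ?A)"
    by (auto simp: length_Suc_conv image_iff)
  have inj: "inj_on (\<lambda>(x, xs). x # xs) (S \<times> ?A)"
    by (auto simp: inj_on_def)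
  have "(\<Sum>x\<in>S. g x) ^ Suc n = (\<Sum>x\<in>S. \<Sum>xs\<in>?A. g x * prod_list (map g xs))"
    by (simp add: Suc.IH sum_product)
  also have "\<dots> = (\<Sum>(x, xs)\<in>S \<times> ?A. g x * prod_list (map g xs))"
    by (rule sum.cartesian_product)
  also have "\<dots> = (\<Sum>xs\<in>(\<lambda>(x, xs). x # xs) ` (S \<times> ?A). prod_list (map g xs))"
    by (subst sum.reindex[OF inj]) (simp add: split_beta)
  finally show ?case by (simp add: eq)
qed

lemma single_power:
  "Poly_Mapping.single k c ^ n = Poly_Mapping.single (\<Sum>i<n. k) (c ^ n)"
  for k :: "'a::comm_monoid_add" and c :: complex
  by (induction n) (simp_all add: mult_single add.commute)

section \<open>Multihomogeneity\<close>

definition grade :: "('a \<Rightarrow> 'b) \<Rightarrow> 'b \<Rightarrow> ('a \<Rightarrow>\<^sub>0 complex) \<Rightarrow> bool" where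
  "grade h d p \<longleftrightarrow> (\<forall>k\<in>Poly_Mapping.keys p. h k = d)"

lemma grade_mult:
  fixes p q :: "'a::monoid_add \<Rightarrow>\<^sub>0 complex"
  assumes "\<And>j k. h (j + k) = h j + h k" "grade h d p" "grade h e q"
  shows "grade h (d + e) (p * q)"
  unfolding grade_def
proof
  fix k assume "k \<in> Poly_Mapping.keys (p * q)"
  then obtain a b where "k = a + b" "a \<in> Poly_Mapping.keys p" "b \<in> Poly_Mapping.keys q"
    using keys_mult[of p q] by blast
  then show "h k = d + e" using assms by (auto simp: grade_def)
qed

lemma grade_add: "grade h d p \<Longrightarrow> grade h d q \<Longrightarrow> grade h d (p + q)"
  using keys_add[of p q] by (auto simp: grade_def)

lemma grade_scale: "grade h d p \<Longrightarrow> grade h d (scale c p)"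
  by (auto simp: grade_def in_keys_iff)

lemma grade_single: "h k = d \<Longrightarrow> grade h d (Poly_Mapping.single k c)"
  by (auto simp: grade_def)

lemma grade_power:
  fixes p :: "'a::comm_monoid_add \<Rightarrow>\<^sub>0 complex" and h :: "'a \<Rightarrow> int"
  assumes "\<And>j k. h (j + k) = h j + h k" "grade h d p"
  shows "grade h (int n * d) (p ^ n)"
proof (induction n)
  case 0
  have "h 0 = 0" using assms(1)[of 0 0] by simp
  then show ?case by (simp add: grade_def)
next
  case (Suc n)
  have "int (Suc n) * d = d + int n * d" by (simp add: algebra_simps)
  then show ?case using grade_mult[of h, OF assms Suc.IH] by simp
qed

section \<open>The generating function of the polynomials \<open>D_mat\<close>\<close>

type_synonym gen_exp = "((nat^2) \<times> (nat^2)) \<times> (nat^2^2)"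
type_synonym gen_alg = "gen_exp \<Rightarrow>\<^sub>0 complex"

definition cols :: "nat^2^2 \<Rightarrow> (nat^2) \<times> (nat^2)" where
  "cols N = (column 1 N, column 2 N)"

definition of_cols :: "(nat^2) \<times> (nat^2) \<Rightarrow> nat^2^2" where
  "of_cols = (\<lambda>(a, b). \<chi> i j. if j = 1 then a $ i else b $ i)"

lemma two_neq_one [simp]: "(2::2) \<noteq> 1" "(1::2) \<noteq> 2"
  by simp_all

lemma sum_UNIV_2: "(\<Sum>i\<in>UNIV. f i) = f 1 + f (2::2)"
  and prod_UNIV_2: "(\<Prod>i\<in>UNIV. g i) = g 1 * g (2::2)"
  by (simp_all add: UNIV_2)

lemma axis_nth_if: "axis i x $ j = (if j = i then x else 0)"
  by (simp add: axis_def)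

lemma cols_of_cols [simp]: "cols (of_cols m) = m"
  by (cases m) (simp add: cols_def of_cols_def column_def vec_eq_iff forall_2)

lemma of_cols_cols [simp]: "of_cols (cols N) = N"
  by (simp add: cols_def of_cols_def column_def vec_eq_iff forall_2)

lemma of_cols_eq_iff: "of_cols m = N \<longleftrightarrow> m = cols N"
  by (metis cols_of_cols of_cols_cols)

lemma cols_add: "cols (M + N) = cols M + cols N"
  by (simp add: cols_def column_def vec_eq_iff)

lemma cols_0: "cols 0 = 0"
  by (simp add: cols_def column_def vec_eq_iff zero_prod_def)

lemma cols_sum_list: "cols (sum_list Ms) = sum_list (map cols Ms)"
  by (induction Ms) (auto simp: cols_add cols_0)

text \<open>
  An exponent pair \<open>m\<close> in \<open>gen_exp\<close> stands for a monomial \<open>a\<^sup>m\<close> in variables \<open>a\<^sub>1, a\<^sub>2, b\<^sub>1, b\<^sub>2\<close> dual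
  to the basis vectors of the two tensor factors; \<open>contract t\<close> replaces \<open>a\<^sup>m\<close> by its value \<open>m! t\<^sub>m\<close>
  under the apolar pairing with \<open>t\<close>. The \<open>l\<close>-th power of
  \<open>gen_fun \<alpha> = \<Sum> a\<^bsub>k\<^sub>1\<^esub> b\<^bsub>k\<^sub>2\<^esub> D(k\<^sub>1, k\<^sub>2)\<close> then produces all \<open>D_mat l \<alpha> M\<close> at once, and it is
  quadratic in the forms \<open>lin_form j k = \<Sum>\<^sub>i c\<^sub>i x\<^sub>i\<^sub>k\<close> with \<open>c = a\<close> if \<open>j = 1\<close> and \<open>c = b\<close> if \<open>j = 2\<close>.
\<close>

definition attach :: "(nat^2) \<times> (nat^2) \<Rightarrow> xpoly \<Rightarrow> gen_alg" where
  "attach m = lin_ext (\<lambda>N. Poly_Mapping.single (m, N) 1)"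

definition weight :: "sym_tensor \<Rightarrow> (nat^2) \<times> (nat^2) \<Rightarrow> complex" where
  "weight t = (\<lambda>(a, b). Poly_Mapping.lookup t (a, b) *
     (fact (a $ 1) * fact (a $ 2) * fact (b $ 1) * fact (b $ 2)))"

lemma weight_of_cols:
  "weight t m = Poly_Mapping.lookup t m * (fact (of_cols m $ 1 $ 1) * fact (of_cols m $ 2 $ 1) *
     fact (of_cols m $ 1 $ 2) * fact (of_cols m $ 2 $ 2))"
  by (cases m) (simp add: weight_def of_cols_def ac_simps)

definition contract :: "sym_tensor \<Rightarrow> gen_alg \<Rightarrow> xpoly" where
  "contract t = lin_ext (\<lambda>(m, N). Poly_Mapping.single N (weight t m))"

lemma attach_single [simp]: "attach m (Poly_Mapping.single N c) = Poly_Mapping.single (m, N) c"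
  by (simp add: attach_def)

lemma attach_0 [simp]: "attach m 0 = 0"
  by (simp add: attach_def)

lemma attach_add: "attach m (p + q) = attach m p + attach m q"
  by (simp add: attach_def lin_ext_add)

lemma attach_mult: "attach m p * attach n q = attach (m + n) (p * q)"
proof (induction p rule: monoid_algebra_induct)
  case (single j c)
  show ?case
    by (induction q rule: monoid_algebra_induct)
       (auto simp: mult_single attach_add distrib_left)
qed (auto simp: attach_add distrib_right)

lemma attach_prod_list:
  "prod_list (map (\<lambda>N. attach (f N) (g N)) Ms) = attach (sum_list (map f Ms)) (prod_list (map g Ms))"
proof (induction Ms)
  case Nil
  have "attach 0 1 = attach 0 (Poly_Mapping.single 0 1)" by simp
  also have "\<dots> = Poly_Mapping.single 0 1" by (simp only: attach_single zero_prod_def)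
  finally show ?case by simp
qed (simp add: attach_mult)

lemma contract_attach: "contract t (attach m p) = scale (weight t m) p"
  by (induction p rule: monoid_algebra_induct)
     (auto simp: contract_def attach_def lin_ext_add scale_add mult.commute)

definition lin_form :: "2 \<Rightarrow> 2 \<Rightarrow> gen_alg" where
  "lin_form j k = (\<Sum>i\<in>UNIV. Poly_Mapping.single
     (if j = 1 then (axis i 1, 0) else (0, axis i 1), axis i (axis k 1)) 1)"

definition gen_fun :: "complex \<Rightarrow> gen_alg" where
  "gen_fun \<alpha> = lin_form 1 1 * lin_form 2 2 + scale \<alpha> (lin_form 2 1 * lin_form 1 2)"

lemma column_unit: "a $ 1 + a $ 2 = 1 \<longleftrightarrow> a = axis 1 1 \<or> a = axis 2 (1::nat)" for a :: "nat^2"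
  by (auto simp: vec_eq_iff forall_2 axis_def)

lemma MM_1: "MM 1 = range (\<lambda>(i, j). of_cols (axis i 1, axis j 1))" (is "_ = ?R")
proof (intro equalityI subsetI)
  fix N assume "N \<in> MM 1"
  then obtain i j where "column 1 N = axis i 1" "column 2 N = axis j 1"
    using column_unit[of "column 1 N"] column_unit[of "column 2 N"]
    by (auto simp: MM_def sum_UNIV_2 column_def forall_2)
  then have "cols N = (axis i 1, axis j 1)"
    by (simp add: cols_def)
  then have "N = (\<lambda>(i, j). of_cols (axis i 1, axis j 1)) (i, j)"
    by (metis case_prod_conv of_cols_cols)
  then show "N \<in> ?R" by blast
next
  fix N assume "N \<in> ?R"
  then show "N \<in> MM 1"
    by (auto simp: MM_def of_cols_def sum_UNIV_2 forall_2 axis_def) (metis exhaust_2)+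
qed

lemma D_unit_of_cols: "D_unit \<alpha> (of_cols (axis i 1, axis j 1)) = D_pair \<alpha> i j"
proof -
  have "(THE k. axis i (1::nat) $ k = 1) = i" for i :: 2
    by (rule the_equality) (auto simp: axis_def split: if_splits)
  then show ?thesis by (simp add: D_unit_def of_cols_def)
qed

lemma finite_MM_1: "finite (MM 1)"
  unfolding MM_1 by simp

text \<open>The dual monomial a_i b_j carries x_i1 x_j2 in (a.x1)(b.x2) and x_j1 x_i2 in
  (b.x1)(a.x2), which together make up \<open>D_pair \<alpha> i j\<close>.\<close>

lemma gen_fun_eq: "gen_fun \<alpha> = (\<Sum>N\<in>MM 1. attach (cols N) (D_unit \<alpha> N))"
proof -
  have inj: "inj (\<lambda>(i :: 2, j :: 2). of_cols (axis i 1, axis j 1))"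
    by (auto simp: inj_on_def of_cols_eq_iff axis_eq_axis)
  have "(\<Sum>N\<in>MM 1. attach (cols N) (D_unit \<alpha> N)) =
      (\<Sum>(i, j)\<in>UNIV \<times> UNIV. attach (axis i 1, axis j 1) (D_pair \<alpha> i j))"
    unfolding MM_1 sum.reindex[OF inj]
    by (intro sum.cong) (auto simp: D_unit_of_cols simp del: One_nat_def)
  also have "\<dots> = (\<Sum>i\<in>UNIV. \<Sum>j\<in>UNIV. attach (axis i 1, axis j 1) (D_pair \<alpha> i j))"
    by (rule sum.cartesian_product [symmetric])
  also have "\<dots> = gen_fun \<alpha>"
    by (simp add: gen_fun_def lin_form_def sum_UNIV_2 D_pair_def X_def mult_single attach_add
        distrib_left distrib_right scale_add ac_simps)
  finally show ?thesis by simp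
qed

text \<open>The product of the m_ij! in \<open>D_mat\<close> is the apolar weight of the basis
  element indexed by M, so only 1/(l!)^2 is left over.\<close>

lemma Phi_eq_contract: "Phi l \<alpha> t = scale (1 / (fact l)\<^sup>2) (contract t (gen_fun \<alpha> ^ l))"
proof -
  define A where "A = {Ms. length Ms = l \<and> set Ms \<subseteq> MM 1}"
  define P where "P = (\<lambda>Ms. prod_list (map (D_unit \<alpha>) Ms))"
  have fin: "finite A"
    using finite_lists_length_eq[OF finite_MM_1, of l] by (simp add: A_def conj_commute)
  have "contract t (gen_fun \<alpha> ^ l) =
      (\<Sum>Ms\<in>A. contract t (prod_list (map (\<lambda>N. attach (cols N) (D_unit \<alpha> N)) Ms)))"
    unfolding gen_fun_eq sum_power_eq_sum_lists[OF finite_MM_1] A_def contract_def lin_ext_sum ..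
  also have "\<dots> = (\<Sum>Ms\<in>A. scale (weight t (cols (sum_list Ms))) (P Ms))"
    by (simp add: attach_prod_list contract_attach cols_sum_list P_def)
  finally have contract: "contract t (gen_fun \<alpha> ^ l) = \<dots>" .
  have D: "D_mat l \<alpha> M = (\<Sum>Ms\<in>A. if M = sum_list Ms then
      scale ((fact (M$1$1) * fact (M$1$2) * (fact (M$2$1) * fact (M$2$2))) / (fact l)\<^sup>2) (P Ms) else 0)" for M
  proof -
    have "{Ms. length Ms = l \<and> set Ms \<subseteq> MM 1 \<and> sum_list Ms = M} = A \<inter> {Ms. M = sum_list Ms}"
      by (auto simp: A_def)
    then show ?thesis
      using fin by (simp add: D_mat_def prod_UNIV_2 P_def scale_sum sum.inter_restrict
          if_distrib[of "scale _"] cong: if_cong)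
  qed
  have "Phi l \<alpha> t = (\<Sum>m\<in>Poly_Mapping.keys t. scale (Poly_Mapping.lookup t m) (D_mat l \<alpha> (of_cols m)))"
    by (simp add: Phi_def lin_ext_def of_cols_def split_beta)
  also have "\<dots> = (\<Sum>m\<in>Poly_Mapping.keys t. \<Sum>Ms\<in>A. if m = cols (sum_list Ms)
      then scale (1 / (fact l)\<^sup>2) (scale (weight t m) (P Ms)) else 0)"
    unfolding D scale_sum of_cols_eq_iff
    by (intro sum.cong refl)
       (auto simp: weight_of_cols ac_simps)
  \<comment> \<open>After the exchange each tuple selects the one exponent it sums to; if that lies
    outside the support of \<open>t\<close>, its weight is zero.\<close>
  also have "\<dots> = (\<Sum>Ms\<in>A. \<Sum>m\<in>Poly_Mapping.keys t. if m = cols (sum_list Ms)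
      then scale (1 / (fact l)\<^sup>2) (scale (weight t m) (P Ms)) else 0)"
    by (rule sum.swap)
  also have "\<dots> = (\<Sum>Ms\<in>A. scale (1 / (fact l)\<^sup>2) (scale (weight t (cols (sum_list Ms))) (P Ms)))"
    by (intro sum.cong refl) (auto simp: weight_def in_keys_iff split_beta)
  finally show ?thesis
    by (simp add: contract scale_sum)
qed

section \<open>The raising operator\<close>

text \<open>Undoes the exponent shift of E_12 wherever \<open>a $ 1\<close> is positive; on the dual
  variables it is the shift of a_2 d/da_1.\<close>

definition lower_exp :: "nat^2 \<Rightarrow> nat^2" where
  "lower_exp a = a - axis 1 1 + axis 2 1"

definition raise_exp :: "2 \<Rightarrow> nat^2^2 \<Rightarrow> nat^2^2" where
  "raise_exp k N = N - axis 2 (axis k 1) + axis 1 (axis k 1)"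

text \<open>The operator \<open>E\<^sub>1\<^sub>2 = \<Sum>\<^sub>k x\<^sub>1\<^sub>k \<partial>/\<partial>x\<^sub>2\<^sub>k\<close>.\<close>

definition raise_mono :: "nat^2^2 \<Rightarrow> xpoly" where
  "raise_mono N = Poly_Mapping.single (raise_exp 1 N) (of_nat (N $ 2 $ 1)) +
     Poly_Mapping.single (raise_exp 2 N) (of_nat (N $ 2 $ 2))"

text \<open>
  The infinitesimal action on the generating algebra that fixes the pairing of the variables
  \<open>x\<^sub>i\<^sub>k\<close> with the dual variables, so that every \<open>lin_form\<close> is invariant.
\<close>

definition invar_mono :: "gen_exp \<Rightarrow> gen_alg" where
  "invar_mono = (\<lambda>k.
     Poly_Mapping.single (fst k, raise_exp 1 (snd k)) (of_nat (snd k $ 2 $ 1)) +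
     Poly_Mapping.single (fst k, raise_exp 2 (snd k)) (of_nat (snd k $ 2 $ 2)) +
     (Poly_Mapping.single ((lower_exp (fst (fst k)), snd (fst k)), snd k) (- of_nat (fst (fst k) $ 1)) +
      Poly_Mapping.single ((fst (fst k), lower_exp (snd (fst k))), snd k) (- of_nat (snd (fst k) $ 1))))"

lemma raise_exp_add: "N $ 2 $ k \<noteq> 0 \<Longrightarrow> raise_exp k (M + N) = M + raise_exp k N"
  using exhaust_2[of k] by (auto simp: raise_exp_def vec_eq_iff forall_2 axis_def)

lemma lower_exp_add: "b $ 1 \<noteq> 0 \<Longrightarrow> lower_exp (a + b) = a + lower_exp b"
  by (simp add: lower_exp_def vec_eq_iff forall_2 axis_def)

lemma invar_derivation:
  "lin_ext invar_mono (p * q) = p * lin_ext invar_mono q + q * lin_ext invar_mono p"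
proof (rule lin_ext_derivation)
  fix j k
  note shift_derivation[where f = "\<lambda>k :: gen_exp. (fst k, raise_exp 1 (snd k))"
      and c = "\<lambda>k. of_nat (snd k $ 2 $ 1)" and j = j and k = k]
    shift_derivation[where f = "\<lambda>k :: gen_exp. (fst k, raise_exp 2 (snd k))"
      and c = "\<lambda>k. of_nat (snd k $ 2 $ 2)" and j = j and k = k]
    shift_derivation[where f = "\<lambda>k :: gen_exp. ((lower_exp (fst (fst k)), snd (fst k)), snd k)"
      and c = "\<lambda>k. - of_nat (fst (fst k) $ 1)" and j = j and k = k]
    shift_derivation[where f = "\<lambda>k :: gen_exp. ((fst (fst k), lower_exp (snd (fst k))), snd k)"
      and c = "\<lambda>k. - of_nat (snd (fst k) $ 1)" and j = j and k = k]
  then show "invar_mono (j + k) = Poly_Mapping.single j 1 * invar_mono k + Poly_Mapping.single k 1 * invar_mono j"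
    by (simp add: invar_mono_def raise_exp_add lower_exp_add plus_prod_def distrib_left ac_simps)
qed

text \<open>The form is c_1 x_1k + c_2 x_2k; its terms go to - c_2 x_1k and c_2 x_1k, which
  cancel.\<close>

lemma invar_lin_form: "lin_ext invar_mono (lin_form j k) = 0"
proof -
  have [simp]: "raise_exp k (axis 2 (axis k 1)) = axis 1 (axis k 1)" for k
    by (simp add: raise_exp_def)
  have [simp]: "lower_exp (axis 1 1) = axis 2 1"
    by (simp add: lower_exp_def)
  show ?thesis
    using exhaust_2[of j] exhaust_2[of k]
    by (auto simp: lin_form_def sum_UNIV_2 lin_ext_add invar_mono_def axis_nth_if simp del: One_nat_def simp flip: single_add)
qed

lemma invar_gen_fun: "lin_ext invar_mono (gen_fun \<alpha> ^ n) = 0"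
  by (rule derivation_power_eq_0[OF invar_derivation])
     (simp add: gen_fun_def lin_ext_add lin_ext_scale invar_derivation invar_lin_form)

text \<open>The hypothesis is E_12 t = 0 in terms of weights. It annihilates the part of
  \<open>invar_mono\<close> acting on the dual variables, so only the action on x survives
  contraction.\<close>

lemma raise_contract:
  assumes "\<And>a b. of_nat (a $ 1) * weight t (lower_exp a, b) + of_nat (b $ 1) * weight t (a, lower_exp b) = 0"
  shows "lin_ext raise_mono (contract t q) = contract t (lin_ext invar_mono q)"
proof -
  have "lin_ext raise_mono (Poly_Mapping.single (snd k) (weight t (fst k))) = contract t (invar_mono k)" for k
  proof -
    obtain a b N where k: "k = ((a, b), N)" by (metis prod.collapse)
    have "contract t (invar_mono k) =
      lin_ext raise_mono (Poly_Mapping.single N (weight t (a, b))) +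
      Poly_Mapping.single N (- (of_nat (a $ 1) * weight t (lower_exp a, b) + of_nat (b $ 1) * weight t (a, lower_exp b)))"
      by (simp add: k contract_def invar_mono_def lin_ext_add raise_mono_def scale_add ac_simps
          flip: single_add)
    then show ?thesis unfolding assms by (simp add: k)
  qed
  then show ?thesis
    unfolding contract_def lin_ext_lin_ext by (simp add: case_prod_unfold)
qed

section \<open>Coefficients of the gl_2-action on the tensor square\<close>

lemma gl_tensor_eq: "gl_tensor i j = lin_ext (\<lambda>m.
    Poly_Mapping.single (fst m - axis j 1 + axis i 1, snd m) (of_nat (fst m $ j)) +
    Poly_Mapping.single (fst m, snd m - axis j 1 + axis i 1) (of_nat (snd m $ j)))"
  by (simp add: gl_tensor_def gl_sym_def tensor_def case_prod_unfold)

lemma lookup_gl_tensor_diag: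
  "Poly_Mapping.lookup (gl_tensor i i t) (a, b) = of_nat (a $ i + b $ i) * Poly_Mapping.lookup t (a, b)"
proof -
  have *: "c - axis i 1 + axis i 1 = c" if "c $ i \<noteq> 0" for c :: "nat^2"
    using that by (simp add: vec_eq_iff axis_def)
  show ?thesis
    unfolding gl_tensor_eq lin_ext_plus lookup_add
    by (subst (1 2) lookup_lin_ext_shift[where i = "(a, b)"]) (auto simp: * ring_distribs mult.commute simp del: One_nat_def)
qed

lemma lower_exp_eq_iff:
  fixes a c :: "nat^2"
  assumes "a $ 1 \<noteq> 0"
  shows "c $ 2 \<noteq> 0 \<Longrightarrow> c - axis 2 1 + axis 1 1 = a \<longleftrightarrow> c = lower_exp a"
  using assms by (auto simp: lower_exp_def vec_eq_iff forall_2 axis_def)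

lemma lookup_gl_tensor_12:
  "Poly_Mapping.lookup (gl_tensor 1 2 t) (a, b) =
     (if a $ 1 = 0 then 0 else Poly_Mapping.lookup t (lower_exp a, b) * of_nat (a $ 2 + 1)) +
     (if b $ 1 = 0 then 0 else Poly_Mapping.lookup t (a, lower_exp b) * of_nat (b $ 2 + 1))"
proof -
  have 0: "c - axis 2 1 + axis 1 1 \<noteq> a" if "a $ 1 = 0" for a c :: "nat^2"
    using that by (auto simp: vec_eq_iff forall_2 axis_def)
  have [simp]: "lower_exp a $ 2 = a $ 2 + 1" for a
    by (simp add: lower_exp_def axis_def)
  have 1: "Poly_Mapping.lookup (lin_ext (\<lambda>m. Poly_Mapping.single (fst m - axis 2 1 + axis 1 1, snd m) (of_nat (fst m $ 2))) t) (a, b)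
    = (if a $ 1 = 0 then 0 else Poly_Mapping.lookup t (lower_exp a, b) * of_nat (a $ 2 + 1))"
  proof (cases "a $ 1 = 0")
    case False
    then show ?thesis
      by (subst lookup_lin_ext_shift[where i = "(lower_exp a, b)"]) (auto simp: lower_exp_eq_iff simp del: One_nat_def)
  qed (auto intro!: lookup_lin_ext_shift_0 simp: 0)
  have 2: "Poly_Mapping.lookup (lin_ext (\<lambda>m. Poly_Mapping.single (fst m, snd m - axis 2 1 + axis 1 1) (of_nat (snd m $ 2))) t) (a, b)
    = (if b $ 1 = 0 then 0 else Poly_Mapping.lookup t (a, lower_exp b) * of_nat (b $ 2 + 1))"
  proof (cases "b $ 1 = 0")
    case False
    then show ?thesis
      by (subst lookup_lin_ext_shift[where i = "(a, lower_exp b)"]) (auto simp: lower_exp_eq_iff simp del: One_nat_def)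
  qed (auto intro!: lookup_lin_ext_shift_0 simp: 0)
  show ?thesis
    unfolding gl_tensor_eq lin_ext_plus lookup_add 1 2 ..
qed

text \<open>This is the coefficient of E_12 t at (a, b) times a! b!: the factors
  \<open>a $ 1\<close> and \<open>a $ 2 + 1\<close> are absorbed by the shifted factorials, and
  likewise for b.\<close>

lemma weight_invariant:
  assumes "gl_tensor 1 2 t = 0"
  shows "of_nat (a $ 1) * weight t (lower_exp a, b) + of_nat (b $ 1) * weight t (a, lower_exp b) = 0"
proof -
  have [simp]: "lower_exp a $ 2 = a $ 2 + 1" "lower_exp a $ 1 = a $ 1 - 1" for a
    by (simp_all add: lower_exp_def axis_def)
  define F :: complex where "F = fact (a $ 1) * fact (a $ 2) * fact (b $ 1) * fact (b $ 2)"
  have 1: "of_nat (a $ 1) * weight t (lower_exp a, b) =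
      F * (if a $ 1 = 0 then 0 else Poly_Mapping.lookup t (lower_exp a, b) * of_nat (a $ 2 + 1))"
    by (cases "a $ 1") (simp_all add: weight_def F_def algebra_simps)
  have 2: "of_nat (b $ 1) * weight t (a, lower_exp b) =
      F * (if b $ 1 = 0 then 0 else Poly_Mapping.lookup t (a, lower_exp b) * of_nat (b $ 2 + 1))"
    by (cases "b $ 1") (simp_all add: weight_def F_def algebra_simps)
  show ?thesis
    using lookup_gl_tensor_12[of t a b] assms unfolding 1 2 by (simp flip: distrib_left)
qed

lemma raise_Phi: "gl_tensor 1 2 t = 0 \<Longrightarrow> lin_ext raise_mono (Phi l \<alpha> t) = 0"
  by (simp add: Phi_eq_contract lin_ext_scale raise_contract weight_invariant invar_gen_fun)
     (simp add: contract_def)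

section \<open>Solving the highest weight equations\<close>

text \<open>The exponents of \<open>e\<^sub>1\<^bsup>l-i\<^esup> e\<^sub>2\<^bsup>i\<^esup> \<otimes> e\<^sub>1\<^bsup>l-s+i\<^esup> e\<^sub>2\<^bsup>s-i\<^esup>\<close>.\<close>

definition hw_col :: "nat \<Rightarrow> nat \<Rightarrow> nat \<Rightarrow> (nat^2) \<times> (nat^2)" where
  "hw_col l s i = ((\<chi> k. if k = 1 then l - i else i), (\<chi> k. if k = 1 then l - s + i else s - i))"

lemma hw_col_simps [simp]:
  "fst (hw_col l s i) $ 1 = l - i" "fst (hw_col l s i) $ 2 = i"
  "snd (hw_col l s i) $ 1 = l - s + i" "snd (hw_col l s i) $ 2 = s - i"
  by (simp_all add: hw_col_def)

lemma hw_colI: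
  fixes a b :: "nat^2"
  assumes "a $ 1 + a $ 2 = l" "b $ 1 + b $ 2 = l" "a $ 2 + b $ 2 = s" "s \<le> l"
  shows "(a, b) = hw_col l s (a $ 2)"
  using assms by (auto simp: hw_col_def vec_eq_iff forall_2)

text \<open>Absorption (i + 1) C(s, i + 1) = (s - i) C(s, i). The recurrence expresses annihilation
  by E_12 along the exponents \<open>hw_col l s i\<close>, both for v and for Phi(v).\<close>

lemma alternating_recurrence:
  fixes c :: "nat \<Rightarrow> complex"
  assumes "\<And>i. i < s \<Longrightarrow> of_nat (i + 1) * c (i + 1) + of_nat (s - i) * c i = 0"
  shows "i \<le> s \<Longrightarrow> c i = (-1) ^ i * of_nat (s choose i) * c 0"
proof (induction i)
  case (Suc i)
  have "of_nat (Suc i) * c (Suc i) = - (of_nat (s - i) * c i)"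
    using assms[of i] Suc.prems by (simp add: add_eq_0_iff2)
  also have "\<dots> = - (of_nat ((s - i) * (s choose i))) * ((-1) ^ i * c 0)"
    using Suc by simp
  also have "(s - i) * (s choose i) = Suc i * (s choose Suc i)"
    using Suc.prems by (metis binomial_absorb_comp binomial_absorption mult.commute)
  finally have "of_nat (Suc i) * c (Suc i) = of_nat (Suc i) * ((-1) ^ Suc i * of_nat (s choose Suc i) * c 0)"
    by (simp add: algebra_simps)
  then show ?case
    by (subst (asm) mult_left_cancel) (auto simp del: of_nat_Suc)
qed simp

lemma hw_space_lookup:
  assumes v: "v \<in> hw_space l (2 * l - s) s" and s: "s \<le> l"
  shows "i \<le> s \<Longrightarrow> Poly_Mapping.lookup v (hw_col l s i) =
           (-1) ^ i * of_nat (s choose i) * Poly_Mapping.lookup v (hw_col l s 0)"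
    and "Poly_Mapping.lookup v m \<noteq> 0 \<Longrightarrow> \<exists>i\<le>s. m = hw_col l s i"
proof -
  have eq: "gl_tensor 1 2 v = 0" "gl_tensor 2 2 v = scale (of_nat s) v" "v \<in> sym_pow_tensor l"
    using v by (auto simp: hw_space_def)
  show "i \<le> s \<Longrightarrow> Poly_Mapping.lookup v (hw_col l s i) =
           (-1) ^ i * of_nat (s choose i) * Poly_Mapping.lookup v (hw_col l s 0)"
  proof (rule alternating_recurrence)
    fix i assume i: "i < s"
    \<comment> \<open>The exponent (a, b) has total e_2-degree s - 1; within the support of v, E_12
      reaches it exactly from positions i and i + 1.\<close>
    define a :: "nat^2" where "a = (\<chi> k. if k = 1 then l - i else i)"
    define b :: "nat^2" where "b = (\<chi> k. if k = 1 then l - s + i + 1 else s - i - 1)"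
    have "(lower_exp a, b) = hw_col l s (i + 1)" "(a, lower_exp b) = hw_col l s i"
      using i s by (auto simp: a_def b_def hw_col_def lower_exp_def vec_eq_iff forall_2 axis_def)
    then show "of_nat (i + 1) * Poly_Mapping.lookup v (hw_col l s (i + 1)) +
        of_nat (s - i) * Poly_Mapping.lookup v (hw_col l s i) = 0"
      using lookup_gl_tensor_12[of v a b] i s
      by (simp add: eq a_def b_def mult.commute of_nat_diff)
  qed
  assume *: "Poly_Mapping.lookup v m \<noteq> 0"
  obtain a b where m: "m = (a, b)" by (cases m)
  \<comment> \<open>On the support of v the E_22-eigenvalue \<open>a $ 2 + b $ 2\<close> must be
    s.\<close>
  have "of_nat (a $ 2 + b $ 2) * Poly_Mapping.lookup v m = of_nat s * Poly_Mapping.lookup v m"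
    using lookup_gl_tensor_diag[of 2 v a b] by (simp only: eq m lookup_scale)
  then have "a $ 2 + b $ 2 = s"
    using * by (metis mult_right_cancel of_nat_eq_iff)
  moreover have "a $ 1 + a $ 2 = l" "b $ 1 + b $ 2 = l"
    using eq(3) * by (auto simp: sym_pow_tensor_def sum_UNIV_2 m in_keys_iff)
  ultimately show "\<exists>i\<le>s. m = hw_col l s i"
    using hw_colI[of a l b s] s m by (intro exI[of _ "a $ 2"]) auto
qed

lemma inj_hw_col: "inj (hw_col l s)"
  by (rule injI) (metis hw_col_simps(2))

lemma hw_space_nonzero:
  assumes s: "s \<le> l"
  shows "\<exists>v. v \<in> hw_space l (2 * l - s) s \<and> v \<noteq> 0"
proof -
  \<comment> \<open>The binomial expansion of (e_1 \<otimes> e_1)^(l-s) (e_1 \<otimes> e_2 - e_2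
    \<otimes> e_1)^s.\<close>
  define v :: sym_tensor where
    "v = (\<Sum>i\<le>s. Poly_Mapping.single (hw_col l s i) ((-1) ^ i * of_nat (s choose i)))"
  have lookup: "Poly_Mapping.lookup v (hw_col l s i) = (-1) ^ i * of_nat (s choose i)" if "i \<le> s" for i
    using that by (simp add: v_def lookup_sum lookup_single when_def inj_eq[OF inj_hw_col])
  have lookup_0: "Poly_Mapping.lookup v m = 0" if "\<And>i. i \<le> s \<Longrightarrow> m \<noteq> hw_col l s i" for m
    unfolding v_def lookup_sum
    by (rule sum.neutral) (metis atMost_iff lookup_single_not_eq that)
  have lookup_neq: "\<exists>i\<le>s. m = hw_col l s i" if "Poly_Mapping.lookup v m \<noteq> 0" for m
    using that lookup_0 by blast
  have grade: "a $ 1 + a $ 2 = l \<and> b $ 1 + b $ 2 = l \<and> a $ 2 + b $ 2 = s \<and> a $ 1 + b $ 1 = 2 * l - s"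
    if nz: "Poly_Mapping.lookup v (a, b) \<noteq> 0" for a b
  proof -
    obtain i where i: "i \<le> s" "(a, b) = hw_col l s i" using lookup_neq[OF nz] by blast
    then have ab: "a = fst (hw_col l s i)" "b = snd (hw_col l s i)"
      by (metis fst_conv snd_conv)+
    have "(l - i) + i = l" "(l - s + i) + (s - i) = l" "i + (s - i) = s" "(l - i) + (l - s + i) = 2 * l - s"
      using s i(1) by linarith+
    then show ?thesis unfolding ab hw_col_simps by blast
  qed
  have "v \<noteq> 0"
    using lookup[of 0] by auto
  moreover have "v \<in> sym_pow_tensor l"
    using grade by (auto simp: sym_pow_tensor_def sum_UNIV_2 in_keys_iff)
  moreover have "gl_tensor 1 1 v = scale (of_nat (2 * l - s)) v \<and> gl_tensor 2 2 v = scale (of_nat s) v"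
  proof (intro conjI poly_mapping_eqI)
    fix m :: "(nat^2) \<times> (nat^2)"
    obtain a b where m: "m = (a, b)" by (cases m)
    show "Poly_Mapping.lookup (gl_tensor 1 1 v) m = Poly_Mapping.lookup (scale (of_nat (2 * l - s)) v) m"
      and "Poly_Mapping.lookup (gl_tensor 2 2 v) m = Poly_Mapping.lookup (scale (of_nat s) v) m"
      using grade[of a b] unfolding m lookup_gl_tensor_diag lookup_scale
      by (cases "Poly_Mapping.lookup v (a, b) = 0"; auto)+
  qed
  moreover have "gl_tensor 1 2 v = 0"
  proof (rule poly_mapping_eqI)
    fix m :: "(nat^2) \<times> (nat^2)"
    obtain a b where m: "m = (a, b)" by (cases m)
    have [simp]: "lower_exp a $ 2 = a $ 2 + 1" "lower_exp a $ 1 = a $ 1 - 1" for a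
      by (simp_all add: lower_exp_def axis_def)
    show "Poly_Mapping.lookup (gl_tensor 1 2 v) m = Poly_Mapping.lookup 0 m"
    \<comment> \<open>Only at exponents of degrees (l, l) and total e_2-degree s - 1 do shifted
      exponents meet the support of v; there the two contributions cancel by absorption.\<close>
    proof (cases "a $ 1 + a $ 2 = l \<and> b $ 1 + b $ 2 = l \<and> a $ 2 + b $ 2 + 1 = s")
      case True
      then have pos: "a $ 1 > 0" "b $ 1 > 0" "a $ 2 < s" using s by auto
      have "(lower_exp a, b) = hw_col l s (a $ 2 + 1)" "(a, lower_exp b) = hw_col l s (a $ 2)"
        using hw_colI[of "lower_exp a" l b s] hw_colI[of a l "lower_exp b" s] True pos s by auto
      moreover have "(s choose (a $ 2 + 1)) * (a $ 2 + 1) = (s choose (a $ 2)) * (b $ 2 + 1)"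
      proof -
        have "b $ 2 + 1 = s - a $ 2" using True by auto
        then show ?thesis using pos
          by (metis Suc_eq_plus1 binomial_absorb_comp binomial_absorption mult.commute)
      qed
      then have "of_nat (s choose (a $ 2 + 1)) * (of_nat (a $ 2 + 1) :: complex) =
          of_nat (s choose (a $ 2)) * of_nat (b $ 2 + 1)"
        by (metis of_nat_mult)
      ultimately show ?thesis
        using pos by (simp add: m lookup_gl_tensor_12 lookup del: of_nat_add of_nat_Suc)
    next
      case False
      have "Poly_Mapping.lookup v (lower_exp a, b) = 0" if "a $ 1 \<noteq> 0"
        by (rule ccontr, drule grade) (use False that in simp)
      moreover have "Poly_Mapping.lookup v (a, lower_exp b) = 0" if "b $ 1 \<noteq> 0"
        by (rule ccontr, drule grade) (use False that in simp)
      ultimately show ?thesis by (simp add: m lookup_gl_tensor_12)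
    qed
  qed
  ultimately show ?thesis
    by (auto simp: hw_space_def)
qed

text \<open>Every coefficient is a multiple of the one at \<open>hw_col l s 0\<close>, so a nonzero
  vector cannot vanish there.\<close>

lemma hw_vec:
  assumes "s \<le> l"
  shows "hw_vec l s \<in> hw_space l (2 * l - s) s" "Poly_Mapping.lookup (hw_vec l s) (hw_col l s 0) \<noteq> 0"
proof -
  have *: "hw_vec l s \<in> hw_space l (2 * l - s) s \<and> hw_vec l s \<noteq> 0"
    unfolding hw_vec_def by (rule someI_ex[OF hw_space_nonzero[OF assms]])
  then show "hw_vec l s \<in> hw_space l (2 * l - s) s" by blast
  from * obtain m where "Poly_Mapping.lookup (hw_vec l s) m \<noteq> 0"
    by (metis lookup_zero poly_mapping_eqI)
  with hw_space_lookup(2)[of _ l s m] hw_space_lookup(1)[of _ l s] * assms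
  show "Poly_Mapping.lookup (hw_vec l s) (hw_col l s 0) \<noteq> 0"
    by (metis mult_zero_right)
qed

section \<open>The transition scalar\<close>

text \<open>Each term of Q has one variable from each column of x, and each form couples index 2 in
  x with index 2 in the dual variables. The latter balance is a difference, hence the
  integers.\<close>

lemma grade_gen_fun_power:
  "grade (\<lambda>k. int (snd k $ 1 $ j + snd k $ 2 $ j)) (int n) (gen_fun \<alpha> ^ n)"
  "grade (\<lambda>k. int (snd k $ 2 $ 1 + snd k $ 2 $ 2) - int (fst (fst k) $ 2 + snd (fst k) $ 2)) 0 (gen_fun \<alpha> ^ n)"
proof -
  define h where "h = (\<lambda>k :: gen_exp. int (snd k $ 1 $ j + snd k $ 2 $ j))"
  define r where "r = (\<lambda>k :: gen_exp. int (snd k $ 2 $ 1 + snd k $ 2 $ 2) - int (fst (fst k) $ 2 + snd (fst k) $ 2))"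
  have h: "h (p + q) = h p + h q" and r: "r (p + q) = r p + r q" for p q
    by (simp_all add: h_def r_def)
  have h_lin: "grade h (if k = j then 1 else 0) (lin_form i k)" for i k
    by (auto simp: lin_form_def h_def axis_nth_if sum_UNIV_2 intro!: grade_add grade_single)
  have r_lin: "grade r 0 (lin_form i k)" for i k
    using exhaust_2[of k]
    by (auto simp: lin_form_def r_def axis_nth_if sum_UNIV_2 intro!: grade_add grade_single)
  have "grade h 1 (lin_form i 1 * lin_form k 2)" for i k
    using grade_mult[of h, OF h h_lin[of 1 i] h_lin[of 2 k]] exhaust_2[of j] by auto
  moreover have "grade h 1 (lin_form i 2 * lin_form k 1)" for i k
    using grade_mult[of h, OF h h_lin[of 2 i] h_lin[of 1 k]] exhaust_2[of j] by auto
  ultimately have "grade h 1 (gen_fun \<alpha>)"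
    by (auto simp: gen_fun_def intro!: grade_add grade_scale)
  from grade_power[of h, OF h this, of n]
  show "grade (\<lambda>k. int (snd k $ 1 $ j + snd k $ 2 $ j)) (int n) (gen_fun \<alpha> ^ n)"
    by (simp add: h_def)
  have "grade r 0 (lin_form i k * lin_form i' k')" for i k i' k'
    using grade_mult[of r, OF r r_lin r_lin] by auto
  then have "grade r 0 (gen_fun \<alpha>)"
    by (auto simp: gen_fun_def intro!: grade_add grade_scale)
  from grade_power[of r, OF r this, of n]
  show "grade (\<lambda>k. int (snd k $ 2 $ 1 + snd k $ 2 $ 2) - int (fst (fst k) $ 2 + snd (fst k) $ 2)) 0 (gen_fun \<alpha> ^ n)"
    by (simp add: r_def)
qed

lemma lookup_contract:
  "Poly_Mapping.lookup (contract t q) N =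
     (\<Sum>k\<in>Poly_Mapping.keys q. if snd k = N then Poly_Mapping.lookup q k * weight t (fst k) else 0)"
  unfolding contract_def lookup_lin_ext
  by (intro sum.cong) (auto simp: lookup_single when_def)

text \<open>The support of v fixes the total e_2-degree s of the dual exponents; the balance of
  \<open>gen_fun\<close> carries it over to x, and the column degrees do the rest.\<close>

lemma Phi_support:
  assumes "v \<in> hw_space l (2 * l - s) s" "s \<le> l" "Poly_Mapping.lookup (Phi l \<alpha> v) N \<noteq> 0"
  shows "\<exists>i\<le>s. N = of_cols (hw_col l s i)"
proof -
  have "Poly_Mapping.lookup (contract v (gen_fun \<alpha> ^ l)) N \<noteq> 0"
    using assms(3) by (auto simp: Phi_eq_contract)
  then obtain k where k: "k \<in> Poly_Mapping.keys (gen_fun \<alpha> ^ l)" "snd k = N" "weight v (fst k) \<noteq> 0"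
    unfolding lookup_contract
    by (elim sum.not_neutral_contains_not_neutral) (auto split: if_splits)
  obtain i where i: "i \<le> s" "fst k = hw_col l s i"
    using hw_space_lookup(2)[OF assms(1,2), of "fst k"] k(3) by (auto simp: weight_of_cols)
  have "fst (fst k) $ 2 + snd (fst k) $ 2 = s"
    using i by simp
  then have "N $ 1 $ 1 + N $ 2 $ 1 = l" "N $ 1 $ 2 + N $ 2 $ 2 = l" "N $ 2 $ 1 + N $ 2 $ 2 = s"
    using bspec[OF grade_gen_fun_power(1)[unfolded grade_def, where j = 1] k(1)]
      bspec[OF grade_gen_fun_power(1)[unfolded grade_def, where j = 2] k(1)]
      bspec[OF grade_gen_fun_power(2)[unfolded grade_def] k(1)]
    unfolding k(2) by linarith+
  then have "cols N = hw_col l s (N $ 2 $ 1)"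
    unfolding cols_def using hw_colI[of "column 1 N" l "column 2 N" s] assms(2) by (simp add: column_def)
  then show ?thesis
    using \<open>N $ 2 $ 1 + N $ 2 $ 2 = s\<close> by (metis le_add1 of_cols_cols)
qed

text \<open>The formula agrees with that for E_12 on the tensor square, so Phi(v) inherits the
  recurrence of v.\<close>

lemma lookup_raise:
  assumes "a $ 1 \<noteq> 0" "b $ 1 \<noteq> 0"
  shows "Poly_Mapping.lookup (lin_ext raise_mono p) (of_cols (a, b)) =
     Poly_Mapping.lookup p (of_cols (lower_exp a, b)) * of_nat (a $ 2 + 1) +
     Poly_Mapping.lookup p (of_cols (a, lower_exp b)) * of_nat (b $ 2 + 1)"
proof -
  have 1: "raise_exp 1 N = of_cols (a, b) \<longleftrightarrow> N = of_cols (lower_exp a, b)" if "N $ 2 $ 1 \<noteq> 0" for N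
    using that assms
    by (auto simp: raise_exp_def of_cols_def lower_exp_def vec_eq_iff forall_2 axis_nth_if)
  have 2: "raise_exp 2 N = of_cols (a, b) \<longleftrightarrow> N = of_cols (a, lower_exp b)" if "N $ 2 $ 2 \<noteq> 0" for N
    using that assms
    by (auto simp: raise_exp_def of_cols_def lower_exp_def vec_eq_iff forall_2 axis_nth_if)
  have [simp]: "of_cols (lower_exp a, b) $ 2 $ 1 = a $ 2 + 1" "of_cols (a, lower_exp b) $ 2 $ 2 = b $ 2 + 1"
    by (simp_all add: of_cols_def lower_exp_def axis_nth_if)
  have "Poly_Mapping.lookup (lin_ext (\<lambda>N. Poly_Mapping.single (raise_exp 1 N) (of_nat (N $ 2 $ 1))) p) (of_cols (a, b)) =
      Poly_Mapping.lookup p (of_cols (lower_exp a, b)) * of_nat (a $ 2 + 1)"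
    using lookup_lin_ext_shift[of "\<lambda>N. of_nat (N $ 2 $ 1)" "raise_exp 1" "of_cols (a, b)" "of_cols (lower_exp a, b)" p] 1
    by simp
  moreover have "Poly_Mapping.lookup (lin_ext (\<lambda>N. Poly_Mapping.single (raise_exp 2 N) (of_nat (N $ 2 $ 2))) p) (of_cols (a, b)) =
      Poly_Mapping.lookup p (of_cols (a, lower_exp b)) * of_nat (b $ 2 + 1)"
    using lookup_lin_ext_shift[of "\<lambda>N. of_nat (N $ 2 $ 2)" "raise_exp 2" "of_cols (a, b)" "of_cols (a, lower_exp b)" p] 2
    by simp
  ultimately show ?thesis
    unfolding raise_mono_def lin_ext_plus lookup_add by (rule arg_cong2[where f = "(+)"])
qed

text \<open>These are the coefficients of a multiple of (x11 x12)^(l-s) (x11 x22 - x21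
  x12)^s.\<close>

lemma Phi_lookup:
  assumes v: "v \<in> hw_space l (2 * l - s) s" and s: "s \<le> l"
  shows "i \<le> s \<Longrightarrow> Poly_Mapping.lookup (Phi l \<alpha> v) (of_cols (hw_col l s i)) =
    (-1) ^ i * of_nat (s choose i) * Poly_Mapping.lookup (Phi l \<alpha> v) (of_cols (hw_col l s 0))"
proof (rule alternating_recurrence)
  fix i assume i: "i < s"
  define a :: "nat^2" where "a = (\<chi> k. if k = 1 then l - i else i)"
  define b :: "nat^2" where "b = (\<chi> k. if k = 1 then l - s + i + 1 else s - i - 1)"
  have "(lower_exp a, b) = hw_col l s (i + 1)" "(a, lower_exp b) = hw_col l s i"
    using i s by (auto simp: a_def b_def hw_col_def lower_exp_def vec_eq_iff forall_2 axis_def)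
  moreover have "lin_ext raise_mono (Phi l \<alpha> v) = 0"
    using v by (simp add: raise_Phi hw_space_def)
  ultimately show "of_nat (i + 1) * Poly_Mapping.lookup (Phi l \<alpha> v) (of_cols (hw_col l s (i + 1))) +
      of_nat (s - i) * Poly_Mapping.lookup (Phi l \<alpha> v) (of_cols (hw_col l s i)) = 0"
    using lookup_raise[of a b "Phi l \<alpha> v"] i s
    by (simp add: a_def b_def mult.commute of_nat_diff)
qed

text \<open>
  The proportionality factor is read off at the monomial \<open>x\<^sub>1\<^sub>1\<^sup>l x\<^sub>1\<^sub>2\<^bsup>l-s\<^esup> x\<^sub>2\<^sub>2\<^sup>s\<close>, so one may set
  \<open>x\<^sub>2\<^sub>1 = 0\<close>: this leaves \<open>lead_part\<close>, and what is dropped is a multiple of \<open>x\<^sub>2\<^sub>1\<close> (\<open>vanishing\<close>).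
\<close>

definition lead_part :: "complex \<Rightarrow> gen_alg" where
  "lead_part \<alpha> = Poly_Mapping.single ((axis 1 1, axis 1 1), axis 1 1) (1 + \<alpha>) +
     (Poly_Mapping.single ((axis 2 1, axis 1 1), axis 1 (axis 1 1) + axis 2 (axis 2 1)) \<alpha> +
      Poly_Mapping.single ((axis 1 1, axis 2 1), axis 1 (axis 1 1) + axis 2 (axis 2 1)) 1)"

definition vanishing :: "gen_alg \<Rightarrow> bool" where
  "vanishing p \<longleftrightarrow> (\<forall>k\<in>Poly_Mapping.keys p. snd k $ 2 $ 1 \<noteq> 0)"

lemma vanishing_mult: "vanishing p \<Longrightarrow> vanishing (p * q)"
  using keys_mult[of p q] by (fastforce simp: vanishing_def)

lemma vanishing_contract: "vanishing p \<Longrightarrow> N $ 2 $ 1 = 0 \<Longrightarrow> Poly_Mapping.lookup (contract t p) N = 0"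
  unfolding lookup_contract by (rule sum.neutral) (auto simp: vanishing_def)

lemma vanishing_gen_fun: "vanishing (gen_fun \<alpha> - lead_part \<alpha>)"
proof -
  \<comment> \<open>On the left the inner 1 is the all-one vector of \<open>nat^2\<close>, so this
    is the exponent of x11 x12.\<close>
  have 1: "axis 1 1 = (axis 1 (axis 1 1) + axis 1 (axis 2 (1::nat)) :: nat^2^2)"
    by (simp add: vec_eq_iff forall_2 axis_nth_if)
  \<comment> \<open>In Q the variable x21 occurs only in a_2 x21 and b_2 x21.\<close>
  have "gen_fun \<alpha> - lead_part \<alpha> =
      Poly_Mapping.single ((axis 2 1, 0), axis 2 (axis 1 1)) 1 * lin_form 2 2 +
      Poly_Mapping.single ((0, axis 2 1), axis 2 (axis 1 1)) 1 * scale \<alpha> (lin_form 1 2)"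
    by (simp add: gen_fun_def lead_part_def lin_form_def sum_UNIV_2 mult_single distrib_left distrib_right
        scale_add scale_mult_right 1 single_add ac_simps)
  moreover have "vanishing (p + q)" if "vanishing p" "vanishing q" for p q
    using that keys_add[of p q] by (auto simp: vanishing_def)
  moreover have "vanishing (Poly_Mapping.single (m, axis 2 (axis 1 1)) 1)" for m
    by (simp add: vanishing_def axis_nth_if)
  ultimately show ?thesis by (simp add: vanishing_mult)
qed

text \<open>The difference of the n-th powers is divisible by
  \<open>gen_fun \<alpha> - lead_part \<alpha>\<close>, all of whose monomials contain x21.\<close>

lemma contract_gen_fun_power:
  assumes "N $ 2 $ 1 = 0"
  shows "Poly_Mapping.lookup (contract t (gen_fun \<alpha> ^ n)) N = Poly_Mapping.lookup (contract t (lead_part \<alpha> ^ n)) N"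
proof -
  define Z where "Z = (\<Sum>i<n. lead_part \<alpha> ^ (n - Suc i) * gen_fun \<alpha> ^ i)"
  have "gen_fun \<alpha> ^ n - lead_part \<alpha> ^ n = (gen_fun \<alpha> - lead_part \<alpha>) * Z"
    unfolding Z_def by (rule power_diff_sumr2)
  then have eq: "gen_fun \<alpha> ^ n = lead_part \<alpha> ^ n + (gen_fun \<alpha> - lead_part \<alpha>) * Z"
    by (simp add: algebra_simps)
  have "Poly_Mapping.lookup (contract t ((gen_fun \<alpha> - lead_part \<alpha>) * Z)) N = 0"
    using assms by (intro vanishing_contract vanishing_mult vanishing_gen_fun)
  then show ?thesis
    by (simp add: eq contract_def lin_ext_add lookup_add)
qed

text \<open>The trinomial theorem as two nested binomial expansions: k factors a_1 b_1 x11 x12, m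
  factors a_2 b_1 x11 x22, and l - k - m factors a_1 b_2 x11 x22.\<close>

lemma lead_part_power:
  "lead_part \<alpha> ^ l = (\<Sum>k\<le>l. \<Sum>m\<le>l - k. Poly_Mapping.single
     (((\<chi> i. if i = 1 then l - m else m), (\<chi> i. if i = 1 then k + m else l - k - m)),
      of_cols ((\<chi> i. if i = 1 then l else 0), (\<chi> i. if i = 1 then k else l - k)))
     (of_nat (l choose k) * of_nat ((l - k) choose m) * ((1 + \<alpha>) ^ k * \<alpha> ^ m)))"
proof -
  have of_nat: "of_nat n * Poly_Mapping.single k c = Poly_Mapping.single k (of_nat n * c)" for n k and c :: complex
    by (simp add: mult_single flip: single_of_nat)
  have sum_const_nat: "(\<Sum>i<n. c) = n * c" for n c :: nat
    by simp
  have "lead_part \<alpha> ^ l = (\<Sum>k\<le>l. of_nat (l choose k) *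
      Poly_Mapping.single ((axis 1 1, axis 1 1), axis 1 1) (1 + \<alpha>) ^ k *
      (\<Sum>m\<le>l - k. of_nat ((l - k) choose m) *
        Poly_Mapping.single ((axis 2 1, axis 1 1), axis 1 (axis 1 1) + axis 2 (axis 2 1)) \<alpha> ^ m *
        Poly_Mapping.single ((axis 1 1, axis 2 1), axis 1 (axis 1 1) + axis 2 (axis 2 1)) 1 ^ (l - k - m)))"
    unfolding lead_part_def by (subst binomial_ring, subst binomial_ring) simp
  also have "\<dots> = (\<Sum>k\<le>l. \<Sum>m\<le>l - k. Poly_Mapping.single
     (((\<chi> i. if i = 1 then l - m else m), (\<chi> i. if i = 1 then k + m else l - k - m)),
      of_cols ((\<chi> i. if i = 1 then l else 0), (\<chi> i. if i = 1 then k else l - k)))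
     (of_nat (l choose k) * of_nat ((l - k) choose m) * ((1 + \<alpha>) ^ k * \<alpha> ^ m)))"
    unfolding sum_distrib_left single_power of_nat mult_single
    by (intro sum.cong refl arg_cong2[where f = Poly_Mapping.single])
       (auto simp: prod_eq_iff fst_sum snd_sum vec_eq_iff forall_2 axis_nth_if of_cols_def
        sum_component sum_const_nat simp del: sum_constant)
  finally show ?thesis .
qed

text \<open>\<open>hyp_poly l s\<close> is the hypergeometric polynomial \<open>\<^sub>2F\<^sub>1(-s, l-s+1; -l; x)\<close>.\<close>

definition hyp_poly :: "nat \<Rightarrow> nat \<Rightarrow> complex poly" where
  "hyp_poly l s = (\<Sum>j\<le>s. monom (of_nat (s choose j) * (fact (l - j) * fact (l - s + j)) / (fact l * fact (l - s))) j)"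

definition trans_poly :: "nat \<Rightarrow> nat \<Rightarrow> complex poly" where
  "trans_poly l s = [:1, -1:] ^ (l - s) * hyp_poly l s"

lemma poly_trans_poly_0: "poly (trans_poly l s) 0 = 1"
proof -
  have "poly (hyp_poly l s) 0 = (\<Sum>j\<le>s. if j = 0 then 1 else 0)"
    unfolding hyp_poly_def poly_sum by (rule sum.cong) (auto simp: poly_monom)
  then show ?thesis by (simp add: trans_poly_def)
qed

lemma Phi_lead_coeff:
  assumes v: "v \<in> hw_space l (2 * l - s) s" and s: "s \<le> l"
  shows "Poly_Mapping.lookup (Phi l \<alpha> v) (of_cols (hw_col l s 0)) =
    of_nat (l choose s) * fact s * fact (l - s) / fact l * Poly_Mapping.lookup v (hw_col l s 0) *
    poly (trans_poly l s) (- \<alpha>)"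
proof -
  define N where "N = of_cols (hw_col l s 0)"
  define v0 where "v0 = Poly_Mapping.lookup v (hw_col l s 0)"
  \<comment> \<open>The exponent of x12 is k, so the leading monomial selects k = l - s.\<close>
  have N_iff: "of_cols ((\<chi> i. if i = 1 then l else 0), (\<chi> i. if i = 1 then k else l - k)) = N \<longleftrightarrow> k = l - s"
    if "k \<le> l" for k
    using s that by (auto simp: N_def of_cols_def hw_col_def vec_eq_iff forall_2)
  have col: "((\<chi> i. if i = 1 then l - m else m), (\<chi> i. if i = 1 then l - s + m else l - (l - s) - m)) = hw_col l s m" for m
    using s by (simp add: hw_col_def vec_eq_iff)
  \<comment> \<open>The binomial coefficient completes m! (s - m)! to s!; the factorials left over
    are the numerators in \<open>hyp_poly\<close>.\<close>
  have w: "weight v (hw_col l s m) = (-1) ^ m * fact s * v0 * (fact (l - m) * fact (l - s + m))" if "m \<le> s" for m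
  proof -
    have "fact s = (fact m * fact (s - m) * of_nat (s choose m) :: complex)"
      using arg_cong[OF binomial_fact_lemma[OF that], of "of_nat :: nat \<Rightarrow> complex"]
      by (simp only: of_nat_mult of_nat_fact)
    moreover have "Poly_Mapping.lookup v (hw_col l s m) = (-1) ^ m * of_nat (s choose m) * v0"
      unfolding v0_def by (rule hw_space_lookup(1)[OF v s that])
    ultimately show ?thesis
      unfolding weight_def case_prod_beta by (simp add: ac_simps)
  qed
  have "Poly_Mapping.lookup (contract v (gen_fun \<alpha> ^ l)) N = Poly_Mapping.lookup (contract v (lead_part \<alpha> ^ l)) N"
    by (rule contract_gen_fun_power) (simp add: N_def hw_col_def of_cols_def)
  also have "\<dots> = (\<Sum>k\<le>l. \<Sum>m\<le>l - k. if k = l - s then of_nat (l choose k) * of_nat ((l - k) choose m) *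
       ((1 + \<alpha>) ^ k * \<alpha> ^ m) * weight v (hw_col l s m) else 0)"
    unfolding lead_part_power contract_def lin_ext_sum lookup_sum lin_ext_single
    by (intro sum.cong refl) (auto simp: lookup_single when_def N_iff col)
  also have "\<dots> = (\<Sum>k\<le>l. if k = l - s then \<Sum>m\<le>s. of_nat (l choose s) * of_nat (s choose m) *
       ((1 + \<alpha>) ^ (l - s) * \<alpha> ^ m) * weight v (hw_col l s m) else 0)"
    using s by (intro sum.cong refl) (auto simp: binomial_symmetric[of s l])
  also have "\<dots> = (\<Sum>m\<le>s. of_nat (l choose s) * of_nat (s choose m) *
       ((1 + \<alpha>) ^ (l - s) * \<alpha> ^ m) * weight v (hw_col l s m))"
    using s by simp
  also have "\<dots> = of_nat (l choose s) * fact s * v0 * fact l * fact (l - s) * poly (trans_poly l s) (- \<alpha>)"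
    unfolding trans_poly_def hyp_poly_def poly_mult poly_sum poly_power poly_monom sum_distrib_left
  proof (intro sum.cong refl)
    fix m assume "m \<in> {..s}"
    then have "m \<le> s" by simp
    have "fact l \<noteq> (0 :: complex)" "fact (l - s) \<noteq> (0 :: complex)" by simp_all
    then show "of_nat (l choose s) * of_nat (s choose m) * ((1 + \<alpha>) ^ (l - s) * \<alpha> ^ m) * weight v (hw_col l s m) =
      of_nat (l choose s) * fact s * v0 * fact l * fact (l - s) * (poly [:1, - 1:] (- \<alpha>) ^ (l - s) *
      (of_nat (s choose m) * (fact (l - m) * fact (l - s + m)) / (fact l * fact (l - s)) * (- \<alpha>) ^ m))"
      unfolding w[OF \<open>m \<le> s\<close>] power_minus[of \<alpha>] by simp
  qed
  finally show ?thesis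
    by (simp add: Phi_eq_contract N_def v0_def power2_eq_square)
qed

lemma transition_eq:
  assumes s: "s \<le> l"
  shows "transition l s \<alpha> = poly (trans_poly l s) (- \<alpha>)"
proof -
  define v where "v = hw_vec l s"
  have v: "v \<in> hw_space l (2 * l - s) s" and nz: "Poly_Mapping.lookup v (hw_col l s 0) \<noteq> 0"
    using hw_vec[OF s] by (simp_all add: v_def)
  define C where "C = of_nat (l choose s) * fact s * fact (l - s) / fact l * Poly_Mapping.lookup v (hw_col l s 0)"
  have C: "C \<noteq> 0" using nz s by (simp add: C_def)
  have lead: "Poly_Mapping.lookup (Phi l \<beta> v) (of_cols (hw_col l s 0)) = C * poly (trans_poly l s) (- \<beta>)" for \<beta>
    unfolding C_def by (rule Phi_lead_coeff[OF v s])
  have "Phi l \<alpha> v = scale (poly (trans_poly l s) (- \<alpha>)) (Phi l 0 v)"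
  proof (rule poly_mapping_eqI)
    fix N
    show "Poly_Mapping.lookup (Phi l \<alpha> v) N = Poly_Mapping.lookup (scale (poly (trans_poly l s) (- \<alpha>)) (Phi l 0 v)) N"
    proof (cases "\<exists>i\<le>s. N = of_cols (hw_col l s i)")
      case True
      then obtain i where i: "i \<le> s" "N = of_cols (hw_col l s i)" by blast
      show ?thesis
        unfolding i(2) lookup_scale Phi_lookup[OF v s i(1)] lead by (simp add: poly_trans_poly_0)
    next
      case False
      then show ?thesis using Phi_support[OF v s] by (metis lookup_scale mult_zero_right)
    qed
  qed
  \<comment> \<open>Uniqueness of the scalar: the leading coefficient of Phi(v) at alpha = 0 is
    \<open>C\<close>, which is nonzero.\<close>
  moreover have "c = poly (trans_poly l s) (- \<alpha>)" if "Phi l \<alpha> v = scale c (Phi l 0 v)" for c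
    using lead[of \<alpha>] lead[of 0] C by (simp add: that poly_trans_poly_0)
  ultimately show ?thesis
    unfolding transition_def v_def[symmetric] by (rule the_equality)
qed

section \<open>The differential equation\<close>

lemma coeff_hyp_poly:
  "coeff (hyp_poly l s) n =
     (if n \<le> s then of_nat (s choose n) * (fact (l - n) * fact (l - s + n)) / (fact l * fact (l - s)) else 0)"
  by (simp add: hyp_poly_def coeff_sum)

text \<open>The ratio of consecutive hypergeometric terms, cleared of denominators so that it
  persists at n = s, where n - s ends the series, and beyond.\<close>

lemma coeff_hyp_poly_Suc:
  assumes s: "s \<le> l"
  shows "of_nat (Suc n) * (of_nat n - of_nat l) * coeff (hyp_poly l s) (Suc n) =
    (of_nat n - of_nat s) * (of_nat n + of_nat (l - s) + 1) * coeff (hyp_poly l s) n"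
proof -
  consider "n < s" | "n = s" | "n > s" by linarith
  then show ?thesis
  proof cases
    case 1
    have "Suc n * (s choose Suc n) = (s - n) * (s choose n)"
      by (metis binomial_absorb_comp binomial_absorption mult.commute)
    from arg_cong[OF this, of "of_nat :: nat \<Rightarrow> complex"]
    have c: "of_nat (Suc n) * of_nat (s choose Suc n) = (of_nat s - of_nat n) * (of_nat (s choose n) :: complex)"
      using 1 by (simp only: of_nat_mult of_nat_diff less_imp_le)
    have "l - n = Suc (l - Suc n)" using 1 s by simp
    then have f: "fact (l - n) = (of_nat l - of_nat n) * (fact (l - Suc n) :: complex)"
      using 1 s by (simp add: of_nat_diff algebra_simps)
    have g: "fact (l - s + Suc n) = (of_nat n + of_nat (l - s) + 1) * (fact (l - s + n) :: complex)"
      by (simp add: algebra_simps)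
    have "of_nat (Suc n) * (of_nat n - of_nat l) * coeff (hyp_poly l s) (Suc n) =
      (of_nat (Suc n) * of_nat (s choose Suc n)) * (of_nat n - of_nat l) *
        (fact (l - Suc n) * fact (l - s + Suc n)) / (fact l * fact (l - s))"
      using 1 by (simp add: coeff_hyp_poly)
    also have "\<dots> = (of_nat n - of_nat s) * (of_nat n + of_nat (l - s) + 1) * coeff (hyp_poly l s) n"
      using 1 unfolding c g by (simp add: coeff_hyp_poly f) (simp add: algebra_simps)
    finally show ?thesis .
  qed (simp_all add: coeff_hyp_poly)
qed

text \<open>The hypergeometric equation with A = -s, B = l - s + 1, C = -l: here A + B + 1 = l - 2s
  + 2 and -AB = s (l - s + 1).\<close>

lemma hyp_poly_ode:
  assumes s: "s \<le> l"
  defines "g \<equiv> hyp_poly l s"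
  shows "[:0, 1:] * [:1, -1:] * pderiv (pderiv g) -
     ([:of_nat l:] + smult (of_nat l - 2 * of_nat s + 2) [:0, 1:]) * pderiv g +
     smult (of_nat s * (of_nat l - of_nat s + 1)) g = 0"
proof (rule poly_eqI)
  fix n
  define c where "c = coeff g"
  have 1: "coeff (pCons 0 (pderiv g)) n = of_nat n * c n"
    by (cases n) (simp_all add: coeff_pderiv c_def)
  have 2: "coeff (pCons 0 (pderiv (pderiv g))) n = of_nat n * of_nat (Suc n) * c (Suc n)"
    by (cases n) (simp_all add: coeff_pderiv c_def)
  have 3: "coeff (pCons 0 (pCons 0 (pderiv (pderiv g)))) n = of_nat n * (of_nat n - 1) * c n"
    by (cases n; cases "n - 1") (simp_all add: coeff_pderiv c_def)
  have 4: "coeff (pderiv g) n = of_nat (Suc n) * c (Suc n)"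
    by (simp add: coeff_pderiv c_def)
  have "[:0, 1:] * [:1, -1:] * pderiv (pderiv g) -
     ([:of_nat l:] + smult (of_nat l - 2 * of_nat s + 2) [:0, 1:]) * pderiv g +
     smult (of_nat s * (of_nat l - of_nat s + 1)) g =
     pCons 0 (pderiv (pderiv g)) - pCons 0 (pCons 0 (pderiv (pderiv g))) -
     smult (of_nat l) (pderiv g) - smult (of_nat l - 2 * of_nat s + 2) (pCons 0 (pderiv g)) +
     smult (of_nat s * (of_nat l - of_nat s + 1)) g"
    by (simp add: algebra_simps)
  also have "coeff \<dots> n = of_nat (Suc n) * (of_nat n - of_nat l) * c (Suc n) -
      (of_nat n - of_nat s) * (of_nat n + of_nat (l - s) + 1) * c n"
    using s unfolding coeff_add coeff_diff coeff_smult 1 2 3 4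
    by (simp add: c_def of_nat_diff) (simp add: algebra_simps)
  also have "\<dots> = 0"
    using coeff_hyp_poly_Suc[OF s, of n] by (simp add: c_def g_def)
  finally show "coeff ([:0, 1:] * [:1, -1:] * pderiv (pderiv g) -
     ([:of_nat l:] + smult (of_nat l - 2 * of_nat s + 2) [:0, 1:]) * pderiv g +
     smult (of_nat s * (of_nat l - of_nat s + 1)) g) n = coeff 0 n" by simp
qed

lemma trans_poly_ode:
  assumes s: "s \<le> l"
  defines "f \<equiv> trans_poly l s"
  defines "x \<equiv> [:0, 1:] :: complex poly"
  shows "x * (x - 1)\<^sup>2 * pderiv (pderiv f) + (2 * x * (x - 1) - of_nat l * (x - 1)\<^sup>2) * pderiv f +
     (of_nat s - (of_nat l - of_nat s)\<^sup>2 - of_nat l * x) * f = 0"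
proof -
  define m where "m = l - s"
  define M L S :: "complex poly" where "M = of_nat m" and "L = of_nat l" and "S = of_nat s"
  define y where "y = 1 - x"
  define g where "g = hyp_poly l s"
  have yx: "y = [:1, -1:]" by (simp add: y_def x_def one_pCons)
  have dy: "pderiv y = -1" by (simp add: yx pderiv_pCons one_pCons)
  have L: "L = M + S" using s by (simp add: L_def M_def S_def m_def)
  have dM: "pderiv M = 0" by (simp add: M_def)
  have f: "f = y ^ m * g" by (simp add: f_def trans_poly_def yx m_def g_def)
  \<comment> \<open>The extra factor y avoids the exponent n - 1, which would be truncated at n =
    0.\<close>
  have pow: "y * pderiv (y ^ n) = - of_nat n * y ^ n" for n
    by (induction n) (simp_all add: pderiv_mult dy algebra_simps)
  have 1: "y * pderiv f = y ^ m * (y * pderiv g - M * g)"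
    using pow[of m] by (simp add: f pderiv_mult M_def algebra_simps)
  define h where "h = y * pderiv g - M * g"
  have "pderiv (y * pderiv f) = pderiv (y ^ m * h)"
    by (simp add: 1 h_def)
  then have "y * pderiv (pderiv f) - pderiv f = y ^ m * pderiv h + pderiv (y ^ m) * h"
    by (simp add: pderiv_mult dy algebra_simps)
  then have "y * (y * pderiv (pderiv f) - pderiv f) = y * (y ^ m * pderiv h + pderiv (y ^ m) * h)"
    by simp
  then have "y\<^sup>2 * pderiv (pderiv f) = y * pderiv f + y ^ m * (y * pderiv h) + (y * pderiv (y ^ m)) * h"
    by (simp add: power2_eq_square algebra_simps)
  also have "\<dots> = y ^ m * (h + y * pderiv h - M * h)"
    unfolding pow 1 by (simp add: h_def M_def algebra_simps)
  finally have 2: "y\<^sup>2 * pderiv (pderiv f) = y ^ m * (h + y * pderiv h - M * h)" .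
  have dh: "pderiv h = y * pderiv (pderiv g) - pderiv g - M * pderiv g"
    by (simp add: h_def pderiv_mult pderiv_diff dy dM)
  have ode: "x * y * pderiv (pderiv g) - (L + (L - 2 * S + 2) * x) * pderiv g + S * (L - S + 1) * g = 0"
    using hyp_poly_ode[OF s]
    by (simp add: x_def yx L_def S_def g_def of_nat_poly numeral_poly one_pCons algebra_simps)
  have x: "x - 1 = - y" by (simp add: y_def)
  have "x * (x - 1)\<^sup>2 * pderiv (pderiv f) + (2 * x * (x - 1) - L * (x - 1)\<^sup>2) * pderiv f +
     (S - (L - S)\<^sup>2 - L * x) * f =
     x * (y\<^sup>2 * pderiv (pderiv f)) - (2 * x + L * y) * (y * pderiv f) + (S - M\<^sup>2 - L * x) * (y ^ m * g)"
    unfolding x by (simp add: f L power2_eq_square algebra_simps)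
  \<comment> \<open>One factor y splits off because the coefficient of g vanishes at x = 1: there it
    is M + S - L = 0, the indicial equation.\<close>
  also have "\<dots> = y ^ m * y * (x * y * pderiv (pderiv g) - (L + (L - 2 * S + 2) * x) * pderiv g + S * (L - S + 1) * g)"
    unfolding 1 2 h_def[symmetric] dh unfolding h_def by (simp add: L y_def power2_eq_square algebra_simps)
  also have "\<dots> = 0" unfolding ode by simp
  finally show ?thesis by (simp add: L_def S_def)
qed

theorem corollary4p2:
  fixes l s :: nat
  assumes "s \<le> l"
  shows "\<exists>f :: complex poly.
    (\<forall>x. poly f x = transition l s (- x)) \<and>
    to_fract (pderiv (pderiv f))
      + (2 / (ratx - 1) - of_nat l / ratx) * to_fract (pderiv f)
      + (of_nat s - (of_nat l - of_nat s)\<^sup>2 - of_nat l * ratx) / (ratx * (ratx - 1)\<^sup>2) * to_fract f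
    = 0"
proof (intro exI conjI allI)
  let ?f = "trans_poly l s"
  show "poly ?f x = transition l s (- x)" for x
    by (simp add: transition_eq[OF assms])
  have of_nat: "to_fract (of_nat n) = (of_nat n :: complex poly fract)" for n
    by (induction n) simp_all
  have x_neq_1: "to_fract [:0, 1:] \<noteq> to_fract (1 :: complex poly)"
    unfolding to_fract_eq_iff by (simp add: one_pCons)
  have nz: "ratx \<noteq> 0" "ratx - 1 \<noteq> 0"
    using x_neq_1 by (simp_all add: ratx_def)
  define a where "a = to_fract (pderiv (pderiv ?f))"
  define b where "b = to_fract (pderiv ?f)"
  define c where "c = to_fract ?f"
  define L S :: "complex poly fract" where "L = of_nat l" and "S = of_nat s"
  define q where "q = S - (L - S)\<^sup>2 - L * ratx"
  have "to_fract ([:0, 1:] * ([:0, 1:] - 1)\<^sup>2 * pderiv (pderiv ?f) +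
      (2 * [:0, 1:] * ([:0, 1:] - 1) - of_nat l * ([:0, 1:] - 1)\<^sup>2) * pderiv ?f +
      (of_nat s - (of_nat l - of_nat s)\<^sup>2 - of_nat l * [:0, 1:]) * ?f) = 0"
    by (simp only: trans_poly_ode[OF assms] to_fract_0)
  \<comment> \<open>Writing 2 as 1 + 1 lets the embedding into the fraction field pass through
    it.\<close>
  moreover have "(2 :: complex poly) = 1 + 1" "(2 :: complex poly fract) = 1 + 1" by simp_all
  ultimately have "ratx * (ratx - 1)\<^sup>2 * a + (2 * ratx * (ratx - 1) - L * (ratx - 1)\<^sup>2) * b + q * c = 0"
    by (simp only: to_fract_add to_fract_mult to_fract_diff to_fract_1 of_nat power2_eq_square
        flip: ratx_def a_def b_def c_def L_def S_def q_def) (simp only: q_def power2_eq_square)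
  moreover have "a + (2 / (ratx - 1) - L / ratx) * b + q / (ratx * (ratx - 1)\<^sup>2) * c =
      (ratx * (ratx - 1)\<^sup>2 * a + (2 * ratx * (ratx - 1) - L * (ratx - 1)\<^sup>2) * b + q * c) / (ratx * (ratx - 1)\<^sup>2)"
  proof -
    \<comment> \<open>Here \<open>d\<close> stands for \<open>ratx - 1\<close>; the identity holds
      for independent nonzero \<open>x\<close> and \<open>d\<close>.\<close>
    have "a + (2 / d - L / x) * b + q / (x * d\<^sup>2) * c = (x * d\<^sup>2 * a + (2 * x * d - L * d\<^sup>2) * b + q * c) / (x * d\<^sup>2)"
      if "x \<noteq> 0" "d \<noteq> 0" for x d
      using that by (simp add: field_simps power2_eq_square)
    then show ?thesis using nz .
  qed
  ultimately have "a + (2 / (ratx - 1) - L / ratx) * b + q / (ratx * (ratx - 1)\<^sup>2) * c = 0"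
    by simp
  then show "to_fract (pderiv (pderiv ?f))
      + (2 / (ratx - 1) - of_nat l / ratx) * to_fract (pderiv ?f)
      + (of_nat s - (of_nat l - of_nat s)\<^sup>2 - of_nat l * ratx) / (ratx * (ratx - 1)\<^sup>2) * to_fract ?f = 0"
    by (simp only: a_def b_def c_def L_def S_def q_def)
qed

end
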